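(* Let $n$ be a positive integer. For every integer $t$ with $1 \le t \le \lfloor n/2 \rfloor$, the circulant graph $C(n; t, t+1, \ldots, \lfloor n/2 \rfloor)$ is semi-transitive.
   Context: All graphs are simple and undirected. For a positive integer $n$ and integers $0 < a_1 < a_2 < \cdots < a_k < (n+1)/2$, the circulant graph $C(n; a_1, \ldots, a_k)$ has vertex set $\{0, 1, \ldots, n-1\}$, and two distinct vertices $i, j$ are adjacent if and only if $(i-j) \bmod n$ or $(j-i) \bmod n$ belongs to $\{a_1, \ldots, a_k\}$. A semi-transitive orientation of a graph is an acyclic orientation of its edges such that for every directed path $v_0 \rightarrow v_1 \rightarrow \cdots \rightarrow v_m$ with $m \ge 2$, either there is no arc between $v_0$ and $v_m$, or there is an arc $v_i \rightarrow v_j$ for all $0 \le i < j \le m$. An undirected graph is semi-transitive if it admits a semi-transitive orientation. *)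

theory Defs
  imports Complex_Main "Graph_Theory.Graph_Theory"
begin

text \<open>
  As in \<^theory>\<open>Graph_Theory.Digraph\<close>, a simple undirected graph is a finite loop-free symmetric digraph:
  each edge is present as a pair of opposite arcs.
\<close>

text \<open>
  With S the set of the parameters a1, ..., ak, \<open>circulant_graph n S\<close> is C(n; a1, ..., ak).
  The side condition 0 < a < (n + 1) / 2 on the parameters is kept separate, in \<open>circulant_params\<close>;
  it holds automatically for intervals ending at \<open>\<lfloor>n / 2\<rfloor>\<close>.
\<close>

definition circulant_params :: "int \<Rightarrow> int set \<Rightarrow> bool" where
  "circulant_params n S \<longleftrightarrow> 0 < n \<and> (\<forall>a\<in>S. 0 < a \<and> 2 * a < n + 1)"

definition circulant_graph :: "int \<Rightarrow> int set \<Rightarrow> int pair_pre_digraph" where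
  "circulant_graph n S =
     \<lparr> pverts = {0..<n},
       parcs = {(i, j). i \<in> {0..<n} \<and> j \<in> {0..<n} \<and> i \<noteq> j \<and>
                        ((i - j) mod n \<in> S \<or> (j - i) mod n \<in> S)} \<rparr>"

lemma graph_circulant_graph: "graph (with_proj (circulant_graph n S))"
proof -
  have "finite (parcs (circulant_graph n S))"
    by (rule finite_subset[of _ "{0..<n} \<times> {0..<n}"]) (auto simp: circulant_graph_def)
  then show ?thesis
    by unfold_locales
      (auto simp: circulant_graph_def symmetric_def arc_to_ends_def intro!: symI)
qed

lemma circulant_params_interval:
  assumes "0 < n" "1 \<le> t"
  shows "circulant_params n {t..\<lfloor>real_of_int n / 2\<rfloor>}"
  using assms by (auto simp: circulant_params_def le_floor_iff)

definition orientation_of :: "'a pair_pre_digraph \<Rightarrow> 'a pair_pre_digraph \<Rightarrow> bool" where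
  "orientation_of D G \<longleftrightarrow>
     pverts D = pverts G \<and>
     parcs D \<union> (parcs D)\<inverse> = parcs G \<and>
     parcs D \<inter> (parcs D)\<inverse> = {}"

text \<open>A list \<open>p\<close> of length \<open>m + 1\<close> is the path \<open>p ! 0 \<rightarrow> p ! 1 \<rightarrow> \<dots> \<rightarrow> p ! m\<close>.\<close>

definition semi_transitive_orientation :: "'a pair_pre_digraph \<Rightarrow> 'a pair_pre_digraph \<Rightarrow> bool" where
  "semi_transitive_orientation G D \<longleftrightarrow>
     orientation_of D G \<and>
     acyclic (parcs D) \<and>
     (\<forall>p m. vpath p (with_proj D) \<and> length p = m + 1 \<and> 2 \<le> m \<longrightarrow>
        ((p ! 0, p ! m) \<notin> parcs D \<and> (p ! m, p ! 0) \<notin> parcs D) \<or>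
        (\<forall>i j. i < j \<and> j \<le> m \<longrightarrow> (p ! i, p ! j) \<in> parcs D))"

definition semi_transitive :: "'a pair_pre_digraph \<Rightarrow> bool" where
  "semi_transitive G \<longleftrightarrow> (\<exists>D. semi_transitive_orientation G D)"

end

theory Submission
  imports Defs
begin

text \<open>
  Two vertices \<open>i < j\<close> of \<open>C(n; t, \<dots>, \<lfloor>n/2\<rfloor>)\<close> are adjacent exactly when their cyclic
  distance \<open>min (j - i) (n - (j - i))\<close> is at least \<open>t\<close>, that is, when \<open>t \<le> j - i \<le> n - t\<close>.
  Orient every edge from its smaller to its larger end. This is acyclic, and along a directed path
  every difference \<open>v\<^sub>j - v\<^sub>i\<close> with \<open>i < j\<close> is at least \<open>t\<close>, because each single step is, and at
  most \<open>v\<^sub>m - v\<^sub>0\<close>. If the ends of the path are adjacent, then \<open>v\<^sub>m - v\<^sub>0 \<le> n - t\<close>, so all these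
  differences lie between \<open>t\<close> and \<open>n - t\<close> and the path induces a transitive tournament.
\<close>

text \<open>
  The residues \<open>j - i\<close> and \<open>n - (j - i)\<close> sum to \<open>n\<close>, so the smaller one is at most \<open>n / 2\<close>
  and lies in the parameter interval as soon as both are at least \<open>t\<close>.
\<close>
lemma circulant_interval_arc_iff:
  fixes n t i j :: int
  assumes "1 \<le> t" and "i < j"
  shows "(i, j) \<in> parcs (circulant_graph n {t..\<lfloor>real_of_int n / 2\<rfloor>}) \<longleftrightarrow>
    0 \<le> i \<and> j < n \<and> t \<le> j - i \<and> j - i \<le> n - t"
proof (cases "0 \<le> i \<and> j < n")
  case True
  have "(j - i) mod n = j - i"
    using True assms by simp
  moreover have "(i - j) mod n = n - (j - i)"
    using True assms mod_add_self2 [of "i - j" n] mod_pos_pos_trivial [of "i - j + n" n]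
    by simp
  moreover have "\<lfloor>real_of_int n / 2\<rfloor> = n div 2"
    by (metis floor_divide_of_int_eq of_int_numeral)
  ultimately show ?thesis
    using True assms by (auto simp: circulant_graph_def)
next
  case False
  then show ?thesis
    using assms by (auto simp: circulant_graph_def)
qed

lemma circulant_arc_commute:
  "(i, j) \<in> parcs (circulant_graph n S) \<longleftrightarrow> (j, i) \<in> parcs (circulant_graph n S)"
  by (auto simp: circulant_graph_def)

lemma circulant_arc_irrefl: "(i, i) \<notin> parcs (circulant_graph n S)"
  by (simp add: circulant_graph_def)

definition increasing_orientation :: "'a :: linorder pair_pre_digraph \<Rightarrow> 'a pair_pre_digraph" where
  "increasing_orientation G = \<lparr> pverts = pverts G, parcs = {(i, j) \<in> parcs G. i < j} \<rparr>"

lemma increasing_orientation_of: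
  assumes "sym (parcs G)" and "irrefl (parcs G)"
  shows "orientation_of (increasing_orientation G) G"
  using assms
  by (auto simp: orientation_of_def increasing_orientation_def sym_def irrefl_def)
     (metis linorder_neqE)+

lemma acyclic_increasing_orientation:
  "acyclic (parcs (increasing_orientation G))"
proof -
  have "(i, j) \<in> (parcs (increasing_orientation G))\<^sup>+ \<Longrightarrow> i < j" for i j
    by (induction rule: trancl_induct) (auto simp: increasing_orientation_def)
  then show ?thesis
    by (auto simp: acyclic_def)
qed

lemma vwalk_nth_arc:
  assumes "vwalk p (with_proj D)" and "Suc i < length p"
  shows "(p ! i, p ! Suc i) \<in> parcs D"
  using assms
proof (induction p arbitrary: i rule: list.induct)
  case Nil
  then show ?case by simp
next
  case (Cons x p)
  then show ?case
    by (cases p; cases i) (auto simp: vwalk_def arcs_ends_def arc_to_ends_def)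
qed

lemma gap_of_steps:
  fixes f :: "nat \<Rightarrow> int" and t :: int
  assumes step: "\<And>i. i < m \<Longrightarrow> t \<le> f (Suc i) - f i" and "0 \<le> t" and "i < j" and "j \<le> m"
  shows "t \<le> f j - f i"
  using \<open>i < j\<close> \<open>j \<le> m\<close>
proof (induction j)
  case (Suc j)
  then show ?case
    using step [of j] \<open>0 \<le> t\<close> by (cases "i = j") auto
qed simp

theorem theorem2p5:
  fixes n t :: int
  assumes "0 < n" and "1 \<le> t" and "t \<le> \<lfloor>real_of_int n / 2\<rfloor>"
  shows "semi_transitive (circulant_graph n {t..\<lfloor>real_of_int n / 2\<rfloor>})"
proof -
  define G where "G = circulant_graph n {t..\<lfloor>real_of_int n / 2\<rfloor>}"
  define D where "D = increasing_orientation G"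
  have arc_iff: "(i, j) \<in> parcs D \<longleftrightarrow>
      0 \<le> i \<and> j < n \<and> t \<le> j - i \<and> j - i \<le> n - t" for i j
    using circulant_interval_arc_iff [OF \<open>1 \<le> t\<close>, of i j n] \<open>1 \<le> t\<close>
    by (cases "i < j") (auto simp: D_def G_def increasing_orientation_def)
  have "orientation_of D G"
    unfolding D_def
    by (rule increasing_orientation_of)
       (auto simp: G_def sym_def irrefl_def circulant_arc_irrefl circulant_arc_commute)
  moreover have "acyclic (parcs D)"
    unfolding D_def by (rule acyclic_increasing_orientation)
  moreover have "(p ! i, p ! j) \<in> parcs D"
    if path: "vpath p (with_proj D)" and len: "length p = m + 1"
      and ends: "(p ! 0, p ! m) \<in> parcs D \<or> (p ! m, p ! 0) \<in> parcs D"
      and "2 \<le> m" and "i < j" and "j \<le> m"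
    for p m i j
  proof -
    have "t \<le> p ! Suc k - p ! k" if "k < m" for k
      using vwalk_nth_arc [of p D k] path len that by (auto simp: vpath_def arc_iff)
    then have gap: "t \<le> p ! l - p ! k" if "k < l" "l \<le> m" for k l
      using gap_of_steps [of m t "\<lambda>k. p ! k" k l] \<open>1 \<le> t\<close> that by simp
    have le: "p ! k \<le> p ! l" if "k \<le> l" "l \<le> m" for k l
      using gap [of k l] \<open>1 \<le> t\<close> that by (cases "k = l") auto
    have "(p ! 0, p ! m) \<in> parcs D"
      using ends le [of 0 m] \<open>1 \<le> t\<close> by (auto simp: arc_iff)
    moreover have "p ! 0 \<le> p ! i" "p ! j \<le> p ! m"
      using le \<open>i < j\<close> \<open>j \<le> m\<close> by auto
    ultimately show ?thesis
      using gap [OF \<open>i < j\<close> \<open>j \<le> m\<close>] by (auto simp: arc_iff)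
  qed
  ultimately have "semi_transitive_orientation G D"
    unfolding semi_transitive_orientation_def by blast
  then show ?thesis
    unfolding semi_transitive_def G_def by blast
qed

end
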